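(* Let $D\ge 1$, $\lambda>0$, $\phi\in(0,\pi/2]$, put $c_1=\frac{\lambda^{-1}}{4}\sin^2\phi$ and $c_2=\lambda^{-1}c_1(1-\cos\phi)$, and let $\Phi\in C^2(\mathbb{R}^D)$ satisfy: (H1) $\Phi(q)\ge 0$ for all $q$ and $\int_{\mathbb{R}^D}|q|^2e^{-\Phi(q)}\,dq<\infty$; (H2) there exist $a>0$ and $b\in(0,1)$ such that $$\tfrac12\langle\nabla\Phi(q),q\rangle\ \ge\ b\,\Phi(q)+\frac{(c_1b)^2+c_2b(1-b)}{2(1-b)}|q|^2-a\qquad\text{for all } q\in\mathbb{R}^D.$$ Suppose in addition that: 1. there exists $C>0$ such that $\|D^2\Phi(q)\|\le C$ for all $q\in\mathbb{R}^D$; 2. there exists $C>0$ such that $\Phi(q)\ge C(1+|q|^2)$ for all $q\in\mathbb{R}^D$. Furthermore, assume that the integrator $(\theta_h)_{h>0}$, $\theta_h:\mathbb{R}^{2D}\to\mathbb{R}^{2D}$, is such that, for any $f\in C^2(\mathbb{R}^{2D},\mathbb{R})$ for which there exists $C_1>0$ with $\|D^2f(q,p)\|\le C_1$ for all $(q,p)\in\mathbb{R}^{2D}$, there exists a constant $C_2(f)>0$ such that for all sufficiently small $h>0$, $$f(\theta_h(q,p))=f(q,p)+h\,\mathcal{L}f(q,p)+R_f(q,p,h),\qquad |R_f(q,p,h)|\le C_2(f)\,(1+H(q,p))\,h^2\quad\forall (q,p)\in\mathbb{R}^{2D}.$$ Let $V(q,p)=\frac{|p|^2}{2}+\Phi(q)+c_1\langle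 q,p\rangle+c_2\frac{|q|^2}{2}$. Then, for $h$ sufficiently small, there exist $\gamma_h>0$ and $K_h\ge 0$ such that $$L_h^{(1)}V(q,p)\le-\gamma_hV(q,p)+K_h\qquad\forall (q,p)\in\mathbb{R}^{2D}.$$
   Context: Here $H(q,p)=\frac{|p|^2}{2}+\Phi(q)$ and $\mathcal{L}$ is the Liouville operator $\mathcal{L}f(q,p)=p^T\nabla_qf(q,p)-\nabla\Phi(q)^T\nabla_pf(q,p)$. The map $\theta_h$ advances a numerical solution of Hamilton's equations $\dot q=p$, $\dot p=-\nabla\Phi(q)$ by one time step of length $h>0$. The momentum randomization is $\Gamma(q,p)=(q,\cos(\phi)p+\sin(\phi)\xi)$ with $\xi\sim\mathcal N(0,1)^D$ standard Gaussian. The operator $L_h^{(1)}$ is $$L_h^{(1)}f(q,p)=\lambda^{-1}\,\mathbb{E}\{f(\Gamma(q,p))-f(q,p)\}+h^{-1}\big(f(\theta_h(q,p))-f(q,p)\big),$$ the expectation being over $\xi$. *)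

theory Defs
  imports "HOL-Probability.Probability"
begin

text \<open>
  \<open>\<real>\<^sup>D\<close> is \<open>real ^ 'n\<close> with \<open>D = CARD('n)\<close>, and the phase space
  \<open>\<real>\<^sup>2\<^sup>D\<close> is the product \<open>(real ^ 'n) \<times> (real ^ 'n)\<close>, whose library norm is the
  Euclidean one.
\<close>

definition grad :: "('a::euclidean_space \<Rightarrow> real) \<Rightarrow> 'a \<Rightarrow> 'a" where
  "grad f x = (THE g. GDERIV f x :> g)"

text \<open>The second derivative, as the linear operator given by the Hessian matrix; its
  \<open>norm\<close> is the operator norm.\<close>

definition hess :: "('a::euclidean_space \<Rightarrow> real) \<Rightarrow> 'a \<Rightarrow> ('a \<Rightarrow>\<^sub>L 'a)" where
  "hess f x = Blinfun (frechet_derivative (grad f) (at x))"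

definition C2_fun :: "('a::euclidean_space \<Rightarrow> real) \<Rightarrow> bool" where
  "C2_fun f \<longleftrightarrow>
     (\<forall>x. f differentiable (at x)) \<and>
     (\<forall>x. grad f differentiable (at x)) \<and>
     continuous_on UNIV (hess f)"

definition Ham :: "(real ^ 'n \<Rightarrow> real) \<Rightarrow> (real ^ 'n) \<times> (real ^ 'n) \<Rightarrow> real" where
  "Ham \<Phi> = (\<lambda>(q, p). (norm p)\<^sup>2 / 2 + \<Phi> q)"

definition Liouville ::
  "(real ^ 'n \<Rightarrow> real) \<Rightarrow> ((real ^ 'n) \<times> (real ^ 'n) \<Rightarrow> real)
     \<Rightarrow> (real ^ 'n) \<times> (real ^ 'n) \<Rightarrow> real" where
  "Liouville \<Phi> f = (\<lambda>(q, p).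
     p \<bullet> grad (\<lambda>q'. f (q', p)) q - grad \<Phi> q \<bullet> grad (\<lambda>p'. f (q, p')) p)"

definition std_gaussian :: "(real ^ 'n) measure" where
  "std_gaussian =
     distr (\<Pi>\<^sub>M i\<in>(UNIV :: 'n set). density lborel (\<lambda>x. ennreal (std_normal_density x)))
           borel (\<lambda>x. \<chi> i. x i)"

definition mom_rand ::
  "real \<Rightarrow> real ^ 'n \<Rightarrow> (real ^ 'n) \<times> (real ^ 'n) \<Rightarrow> (real ^ 'n) \<times> (real ^ 'n)" where
  "mom_rand \<phi> \<xi> = (\<lambda>(q, p). (q, cos \<phi> *\<^sub>R p + sin \<phi> *\<^sub>R \<xi>))"

text \<open>\<open>lam\<close> stands for the usual \<open>\<lambda>\<close>, which is reserved syntax.\<close>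

definition Lh1 ::
  "real \<Rightarrow> real \<Rightarrow> (real \<Rightarrow> (real ^ 'n) \<times> (real ^ 'n) \<Rightarrow> (real ^ 'n) \<times> (real ^ 'n)) \<Rightarrow> real
     \<Rightarrow> ((real ^ 'n) \<times> (real ^ 'n) \<Rightarrow> real) \<Rightarrow> (real ^ 'n) \<times> (real ^ 'n) \<Rightarrow> real" where
  "Lh1 lam \<phi> \<theta> h f z =
     inverse lam * (\<integral>\<xi>. (f (mom_rand \<phi> \<xi> z) - f z) \<partial>std_gaussian)
     + inverse h * (f (\<theta> h z) - f z)"

definition c1 :: "real \<Rightarrow> real \<Rightarrow> real" where
  "c1 lam \<phi> = inverse lam / 4 * (sin \<phi>)\<^sup>2"

definition c2 :: "real \<Rightarrow> real \<Rightarrow> real" where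
  "c2 lam \<phi> = inverse lam * c1 lam \<phi> * (1 - cos \<phi>)"

definition Lyap ::
  "real \<Rightarrow> real \<Rightarrow> (real ^ 'n \<Rightarrow> real) \<Rightarrow> (real ^ 'n) \<times> (real ^ 'n) \<Rightarrow> real" where
  "Lyap lam \<phi> \<Phi> = (\<lambda>(q, p).
     (norm p)\<^sup>2 / 2 + \<Phi> q + c1 lam \<phi> * (q \<bullet> p) + c2 lam \<phi> * ((norm q)\<^sup>2 / 2))"

end

theory Submission
  imports Defs
begin

text \<open>
  Write \<open>H\<close> for the Hamiltonian and \<open>V\<close> for the Lyapunov function. The argument compares
  everything with \<open>H\<close>.

  The expectation over the momentum randomization needs only the mean and the second moment of the
  Gaussian, because \<open>V\<close> is quadratic in \<open>p\<close>; by the choice of \<open>c\<^sub>1\<close> and \<open>c\<^sub>2\<close>, the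
  randomization part of the generator contributes \<open>-2c\<^sub>1|p|\<^sup>2 + 2c\<^sub>1D - c\<^sub>2\<langle>q,p\<rangle>\<close> (\<open>expectation_Lyap_mom_rand\<close>). The Hamiltonian flow
  contributes \<open>c\<^sub>1|p|\<^sup>2 + c\<^sub>2\<langle>q,p\<rangle> - c\<^sub>1\<langle>\<nabla>\<Phi>(q),q\<rangle>\<close> (\<open>Liouville_Lyap\<close>): the energy part of
  \<open>V\<close> is conserved, and only the two corrections change. The
  indefinite terms \<open>c\<^sub>2\<langle>q,p\<rangle>\<close> cancel in the sum, and what remains is
  \<open>-c\<^sub>1(|p|\<^sup>2 + \<langle>\<nabla>\<Phi>(q),q\<rangle>) + 2c\<^sub>1D\<close>. By the lower bound on \<open>\<langle>\<nabla>\<Phi>(q),q\<rangle>\<close> this is at most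
  \<open>-2c\<^sub>1bH\<close> up to a constant.

  Replacing the flow by the integrator costs \<open>C\<^sub>2h(1 + H)\<close>. For this the error bound has to be
  applicable to \<open>V\<close>, that is, \<open>V\<close> has to be twice continuously differentiable with bounded
  Hessian; it inherits this from \<open>\<Phi>\<close>, from which it differs by a quadratic form
  (\<open>C2_fun_Lyap\<close>). Once \<open>C\<^sub>2h \<le> c\<^sub>1b\<close>, half of the dissipation absorbs the error and
  \<open>-c\<^sub>1bH\<close> survives. Finally \<open>V \<le> MH\<close>, since the quadratic growth of \<open>\<Phi>\<close> dominates
  the terms in \<open>q\<close> (\<open>Lyap_le_Ham\<close>), so the rate \<open>\<gamma> = c\<^sub>1b/M\<close> works, and neither \<open>\<gamma>\<close> nor
  the additive constant depends on \<open>h\<close>.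
\<close>

section \<open>Gradients and Hessians\<close>

lemma GDERIV_unique:
  assumes "GDERIV f x :> g" "GDERIV f x :> g'"
  shows "g = g'"
proof -
  have "(\<lambda>h. h \<bullet> g) = (\<lambda>h. h \<bullet> g')"
    using assms by (auto simp: gderiv_def intro: has_derivative_unique)
  then show ?thesis
    by (metis vector_eq_ldot)
qed

lemma grad_eqI: "GDERIV f x :> g \<Longrightarrow> grad f x = g"
  unfolding grad_def using GDERIV_unique by blast

text \<open>
  In a Euclidean space every derivative is represented by a vector, so the definite description
  behind \<^const>\<open>grad\<close> denotes the gradient as soon as the function is differentiable.
\<close>

lemma GDERIV_grad:
  assumes "f differentiable (at x)"
  shows "GDERIV f x :> grad f x"
proof -
  obtain D where D: "(f has_derivative D) (at x)"
    using assms by (auto simp: differentiable_def)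
  interpret D: linear D
    using D by (rule has_derivative_linear)
  have "D h = h \<bullet> (\<Sum>b\<in>Basis. D b *\<^sub>R b)" for h
  proof -
    have "D h = D (\<Sum>b\<in>Basis. (h \<bullet> b) *\<^sub>R b)"
      by (simp add: euclidean_representation)
    also have "\<dots> = h \<bullet> (\<Sum>b\<in>Basis. D b *\<^sub>R b)"
      by (simp add: D.sum D.scaleR inner_sum_right mult.commute)
    finally show ?thesis .
  qed
  then have "D = (\<lambda>h. h \<bullet> (\<Sum>b\<in>Basis. D b *\<^sub>R b))"
    by (rule ext)
  with D have "GDERIV f x :> (\<Sum>b\<in>Basis. D b *\<^sub>R b)"
    by (simp only: gderiv_def)
  from grad_eqI[OF this] this show ?thesis
    by simp
qed

lemma hess_eqI: "(grad f has_derivative blinfun_apply A) (at x) \<Longrightarrow> hess f x = A"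
  by (simp add: hess_def frechet_derivative_at[symmetric] blinfun_apply_inverse)

lemma grad_has_derivative_hess:
  assumes "grad f differentiable (at x)"
  shows "(grad f has_derivative blinfun_apply (hess f x)) (at x)"
proof -
  have D: "(grad f has_derivative frechet_derivative (grad f) (at x)) (at x)"
    using assms by (simp add: frechet_derivative_works)
  then show ?thesis
    by (simp add: hess_def bounded_linear_Blinfun_apply has_derivative_bounded_linear)
qed

section \<open>Moments of the standard Gaussian\<close>

abbreviation std_normal :: "real measure" where
  "std_normal \<equiv> density lborel (\<lambda>x. ennreal (std_normal_density x))"

lemma measurable_chi_PiM:
  "(\<lambda>x. \<chi> i. x i) \<in> borel_measurable (\<Pi>\<^sub>M i\<in>(UNIV :: 'n::finite set). std_normal)"
proof (rule borel_measurable_euclidean_space[THEN iffD2], rule ballI)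
  fix b :: "real ^ 'n"
  assume "b \<in> Basis"
  then obtain i where "b = axis i 1"
    by (auto simp: Basis_vec_def)
  then show "(\<lambda>x. (\<chi> i. x i) \<bullet> b) \<in> borel_measurable (\<Pi>\<^sub>M i\<in>(UNIV :: 'n set). std_normal)"
    by (simp add: inner_axis)
qed

lemma measurable_vec_nth [measurable]: "(\<lambda>v. v $ i) \<in> borel_measurable borel"
  by (intro borel_measurable_continuous_onI continuous_intros)

lemma prob_space_std_gaussian: "prob_space (std_gaussian :: (real ^ 'n) measure)"
  unfolding std_gaussian_def
  by (intro prob_space.prob_space_distr prob_space_PiM prob_space_normal_density measurable_chi_PiM) simp

text \<open>
  Integrals of functions of one coordinate reduce to the line, and \<open>v \<bullet> \<xi>\<close> and \<open>|\<xi>|\<^sup>2\<close> are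
  sums of such functions.
\<close>

lemma distr_std_gaussian_component:
  "distr (std_gaussian :: (real ^ 'n) measure) std_normal (\<lambda>\<xi>. \<xi> $ i) = std_normal"
proof -
  have "distr (std_gaussian :: (real ^ 'n) measure) std_normal (\<lambda>\<xi>. \<xi> $ i)
      = distr (\<Pi>\<^sub>M i\<in>(UNIV :: 'n set). std_normal) std_normal (\<lambda>x. x i)"
    unfolding std_gaussian_def
    by (subst distr_distr) (auto simp: measurable_chi_PiM comp_def)
  also have "\<dots> = std_normal"
    by (rule distr_PiM_component) (auto simp: prob_space_normal_density)
  finally show ?thesis .
qed

lemma has_bochner_integral_std_gaussian_component:
  assumes "has_bochner_integral lborel (\<lambda>x. std_normal_density x * g x) I"
    and [measurable]: "g \<in> borel_measurable borel"
  shows "has_bochner_integral (std_gaussian :: (real ^ 'n) measure) (\<lambda>\<xi>. g (\<xi> $ i)) I"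
proof -
  have "has_bochner_integral std_normal g I"
    using assms by (intro has_bochner_integral_density) auto
  then have "has_bochner_integral (distr (std_gaussian :: (real ^ 'n) measure) std_normal (\<lambda>\<xi>. \<xi> $ i)) g I"
    by (simp add: distr_std_gaussian_component)
  moreover have "(\<lambda>\<xi>. \<xi> $ i) \<in> measurable (std_gaussian :: (real ^ 'n) measure) std_normal"
    by (simp add: std_gaussian_def)
  ultimately show ?thesis
    by (simp add: has_bochner_integral_iff integrable_distr_eq integral_distr)
qed

lemma std_gaussian_mean:
  "has_bochner_integral (std_gaussian :: (real ^ 'n) measure) (\<lambda>\<xi>. v \<bullet> \<xi>) 0"
proof -
  have "has_bochner_integral (std_gaussian :: (real ^ 'n) measure) (\<lambda>\<xi>. \<xi> $ i) 0" for i
    using std_normal_moment_odd[of 0] by (intro has_bochner_integral_std_gaussian_component) auto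
  then have "has_bochner_integral (std_gaussian :: (real ^ 'n) measure)
      (\<lambda>\<xi>. \<Sum>i\<in>UNIV. v $ i * \<xi> $ i) (\<Sum>i\<in>UNIV. v $ i * 0)"
    by (intro has_bochner_integral_sum has_bochner_integral_mult_right) auto
  then show ?thesis
    by (simp add: inner_vec_def)
qed

lemma std_gaussian_second_moment:
  "has_bochner_integral (std_gaussian :: (real ^ 'n) measure) (\<lambda>\<xi>. (norm \<xi>)\<^sup>2) (real CARD('n))"
proof -
  have "has_bochner_integral (std_gaussian :: (real ^ 'n) measure) (\<lambda>\<xi>. (\<xi> $ i)\<^sup>2) 1" for i
    using std_normal_moment_even[of 1] by (intro has_bochner_integral_std_gaussian_component) auto
  then have "has_bochner_integral (std_gaussian :: (real ^ 'n) measure)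
      (\<lambda>\<xi>. \<Sum>i\<in>UNIV. (\<xi> $ i)\<^sup>2) (\<Sum>i\<in>(UNIV :: 'n set). 1)"
    by (intro has_bochner_integral_sum) auto
  then show ?thesis
    by (simp add: norm_vec_def L2_set_def sum_nonneg)
qed

section \<open>The Lyapunov function under the two parts of the dynamics\<close>

text \<open>
  The increment of \<open>V\<close> is a quadratic polynomial in \<open>\<xi>\<close>. Its linear part has mean zero, its
  quadratic part is \<open>sin\<^sup>2 \<phi> |\<xi>|\<^sup>2 / 2\<close> with mean \<open>D sin\<^sup>2 \<phi> / 2\<close>, and its constant part is
  the change caused by replacing \<open>p\<close> with \<open>cos \<phi> p\<close>. Division by \<open>\<lambda>\<close> turns
  \<open>sin\<^sup>2 \<phi> / 2\<close> into \<open>2c\<^sub>1\<close> and \<open>c\<^sub>1(1 - cos \<phi>)\<close> into \<open>c\<^sub>2\<close>.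
\<close>

lemma expectation_Lyap_mom_rand:
  fixes q p :: "real ^ 'n"
  assumes "lam > 0"
  shows "inverse lam * (\<integral>\<xi>. (Lyap lam \<phi> \<Phi> (mom_rand \<phi> \<xi> (q, p)) - Lyap lam \<phi> \<Phi> (q, p)) \<partial>std_gaussian)
    = - 2 * c1 lam \<phi> * (norm p)\<^sup>2 + 2 * c1 lam \<phi> * real CARD('n) - c2 lam \<phi> * (q \<bullet> p)"
proof -
  interpret prob_space "std_gaussian :: (real ^ 'n) measure"
    by (rule prob_space_std_gaussian)
  let ?v = "sin \<phi> *\<^sub>R (cos \<phi> *\<^sub>R p + c1 lam \<phi> *\<^sub>R q)"
  let ?k = "((cos \<phi>)\<^sup>2 - 1) * (norm p)\<^sup>2 / 2 - c1 lam \<phi> * (1 - cos \<phi>) * (q \<bullet> p)"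
  have "Lyap lam \<phi> \<Phi> (mom_rand \<phi> \<xi> (q, p)) - Lyap lam \<phi> \<Phi> (q, p)
      = (sin \<phi>)\<^sup>2 / 2 * (norm \<xi>)\<^sup>2 + ?v \<bullet> \<xi> + ?k" for \<xi>
    unfolding Lyap_def mom_rand_def power2_norm_eq_inner
    by (simp add: inner_add_left inner_add_right inner_commute[of \<xi> p] power2_eq_square
        field_simps)
  moreover have "has_bochner_integral std_gaussian
      (\<lambda>\<xi>. (sin \<phi>)\<^sup>2 / 2 * (norm \<xi>)\<^sup>2 + ?v \<bullet> \<xi> + ?k) ((sin \<phi>)\<^sup>2 / 2 * real CARD('n) + 0 + ?k)"
    by (intro has_bochner_integral_add has_bochner_integral_mult_right
        std_gaussian_second_moment std_gaussian_mean)
       (auto simp: prob_space has_bochner_integral_iff)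
  ultimately have *: "(\<integral>\<xi>. (Lyap lam \<phi> \<Phi> (mom_rand \<phi> \<xi> (q, p)) - Lyap lam \<phi> \<Phi> (q, p)) \<partial>std_gaussian)
      = (sin \<phi>)\<^sup>2 / 2 * real CARD('n) + ?k"
    by (simp add: has_bochner_integral_integral_eq)
  show ?thesis
    unfolding * using assms by (simp add: c2_def c1_def cos_squared_eq field_simps)
qed

lemma GDERIV_Lyap:
  assumes "\<And>x. \<Phi> differentiable (at x)"
  shows "GDERIV (Lyap lam \<phi> \<Phi>) z :>
    (grad \<Phi> (fst z) + c1 lam \<phi> *\<^sub>R snd z + c2 lam \<phi> *\<^sub>R fst z, snd z + c1 lam \<phi> *\<^sub>R fst z)"
proof -
  have \<Phi>: "((\<lambda>z. \<Phi> (fst z)) has_derivative (\<lambda>h. fst h \<bullet> grad \<Phi> (fst z))) (at z)"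
    by (rule has_derivative_compose[OF has_derivative_fst[OF has_derivative_ident]
        GDERIV_grad[OF assms, unfolded gderiv_def]])
  have V: "Lyap lam \<phi> \<Phi> = (\<lambda>z. (snd z \<bullet> snd z) / 2 + \<Phi> (fst z) + c1 lam \<phi> * (fst z \<bullet> snd z)
      + c2 lam \<phi> * ((fst z \<bullet> fst z) / 2))"
    by (auto simp: Lyap_def power2_norm_eq_inner)
  show ?thesis
    unfolding gderiv_def V
    by (auto intro!: derivative_eq_intros \<Phi>
        simp: inner_prod_def inner_add_right inner_commute algebra_simps fun_eq_iff)
qed

lemma grad_Lyap:
  assumes "\<And>x. \<Phi> differentiable (at x)"
  shows "grad (Lyap lam \<phi> \<Phi>) = (\<lambda>z.
    (grad \<Phi> (fst z) + c1 lam \<phi> *\<^sub>R snd z + c2 lam \<phi> *\<^sub>R fst z, snd z + c1 lam \<phi> *\<^sub>R fst z))"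
  using GDERIV_Lyap[OF assms] grad_eqI by blast

text \<open>
  The partial gradients in the Liouville operator are the components of the gradient on phase space.
\<close>

lemma GDERIV_slices:
  assumes "GDERIV f (q, p) :> (u, v)"
  shows "GDERIV (\<lambda>q'. f (q', p)) q :> u" "GDERIV (\<lambda>p'. f (q, p')) p :> v"
proof -
  have q: "((\<lambda>q'. (q', p)) has_derivative (\<lambda>h. (h, 0))) (at q)"
    and p: "((\<lambda>p'. (q, p')) has_derivative (\<lambda>h. (0, h))) (at p)"
    by (auto intro!: derivative_eq_intros)
  show "GDERIV (\<lambda>q'. f (q', p)) q :> u" "GDERIV (\<lambda>p'. f (q, p')) p :> v"
    using has_derivative_compose[OF q assms[unfolded gderiv_def]]
      has_derivative_compose[OF p assms[unfolded gderiv_def]]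
    by (simp_all add: gderiv_def)
qed

lemma Liouville_Lyap:
  assumes "\<And>x. \<Phi> differentiable (at x)"
  shows "Liouville \<Phi> (Lyap lam \<phi> \<Phi>) (q, p) =
    c1 lam \<phi> * (norm p)\<^sup>2 + c2 lam \<phi> * (q \<bullet> p) - c1 lam \<phi> * (grad \<Phi> q \<bullet> q)"
proof -
  note G = GDERIV_slices[OF GDERIV_Lyap[OF assms, where z = "(q, p)"]]
  show ?thesis
    unfolding Liouville_def power2_norm_eq_inner
    by (simp add: grad_eqI[OF G(1)] grad_eqI[OF G(2)] inner_add_right inner_commute algebra_simps)
qed

text \<open>
  The gradient of \<open>V\<close> is \<open>\<nabla>\<Phi>\<close> in the position component plus a fixed linear map. Hence its
  derivative is the Hessian of \<open>\<Phi>\<close>, placed in the position block, plus a constant operator, and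
  continuity and boundedness carry over from \<open>\<Phi>\<close>.
\<close>

lemma C2_fun_Lyap:
  fixes \<Phi> :: "real ^ 'n \<Rightarrow> real"
  assumes C2: "C2_fun \<Phi>" and bound: "\<And>q. norm (hess \<Phi> q) \<le> C"
  shows "C2_fun (Lyap lam \<phi> \<Phi>)" "\<exists>C'>0. \<forall>z. norm (hess (Lyap lam \<phi> \<Phi>) z) \<le> C'"
proof -
  have d: "\<Phi> differentiable (at x)" and dg: "grad \<Phi> differentiable (at x)" for x
    using C2 by (auto simp: C2_fun_def)
  define J :: "(real ^ 'n) \<Rightarrow>\<^sub>L ((real ^ 'n) \<times> (real ^ 'n))" where "J = Blinfun (\<lambda>u. (u, 0))"
  have "bounded_linear (\<lambda>u :: real ^ 'n. (u, 0 :: real ^ 'n))"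
    by (intro bounded_linear_intros)
  then have J: "blinfun_apply J u = (u, 0)" for u
    by (simp add: J_def bounded_linear_Blinfun_apply)
  \<comment> \<open>\<open>A\<close> is the Hessian of the quadratic form \<open>V - \<Phi>\<close>.\<close>
  define A :: "((real ^ 'n) \<times> (real ^ 'n)) \<Rightarrow>\<^sub>L ((real ^ 'n) \<times> (real ^ 'n))" where
    "A = Blinfun (\<lambda>w. (c1 lam \<phi> *\<^sub>R snd w + c2 lam \<phi> *\<^sub>R fst w, snd w + c1 lam \<phi> *\<^sub>R fst w))"
  have "bounded_linear (\<lambda>w :: (real ^ 'n) \<times> (real ^ 'n).
      (c1 lam \<phi> *\<^sub>R snd w + c2 lam \<phi> *\<^sub>R fst w, snd w + c1 lam \<phi> *\<^sub>R fst w))"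
    by (intro bounded_linear_intros)
  then have A: "blinfun_apply A w =
      (c1 lam \<phi> *\<^sub>R snd w + c2 lam \<phi> *\<^sub>R fst w, snd w + c1 lam \<phi> *\<^sub>R fst w)" for w
    by (simp add: A_def bounded_linear_Blinfun_apply)
  define B where "B = (\<lambda>z :: (real ^ 'n) \<times> (real ^ 'n). (J o\<^sub>L (hess \<Phi> (fst z) o\<^sub>L fst_blinfun)) + A)"
  have B: "(grad (Lyap lam \<phi> \<Phi>) has_derivative blinfun_apply (B z)) (at z)" for z
  proof -
    have \<Phi>: "((\<lambda>z. grad \<Phi> (fst z)) has_derivative (\<lambda>h. blinfun_apply (hess \<Phi> (fst z)) (fst h))) (at z)"
      by (rule has_derivative_compose[OF has_derivative_fst[OF has_derivative_ident]
          grad_has_derivative_hess[OF dg]])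
    show ?thesis
      unfolding grad_Lyap[OF d] B_def
      by (auto intro!: derivative_eq_intros \<Phi> simp: J A blinfun.add_left fun_eq_iff)
  qed
  have hess: "hess (Lyap lam \<phi> \<Phi>) = B"
    using hess_eqI[OF B] by blast
  have "continuous_on UNIV (\<lambda>z :: (real ^ 'n) \<times> (real ^ 'n). hess \<Phi> (fst z))"
    using C2 unfolding C2_fun_def
    by (auto intro!: continuous_on_compose2[of UNIV "hess \<Phi>"] continuous_on_fst continuous_on_id)
  then have "continuous_on UNIV B"
    unfolding B_def
    by (intro continuous_on_add continuous_on_const
        bounded_bilinear.continuous_on[OF bounded_bilinear_blinfun_compose])
  then show "C2_fun (Lyap lam \<phi> \<Phi>)"
    unfolding C2_fun_def hess
    using GDERIV_Lyap[where \<Phi> = \<Phi>, OF d, unfolded gderiv_def] B by (blast intro: differentiableI)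
  have "norm (B z) \<le> norm J * (C * norm (fst_blinfun :: ((real ^ 'n) \<times> (real ^ 'n)) \<Rightarrow>\<^sub>L _)) + norm A" for z
  proof -
    have "norm (B z) \<le> norm J * (norm (hess \<Phi> (fst z)) * norm (fst_blinfun :: ((real ^ 'n) \<times> (real ^ 'n)) \<Rightarrow>\<^sub>L _)) + norm A"
      unfolding B_def
      by (intro norm_triangle_le add_right_mono order_trans[OF norm_blinfun_compose]
          mult_left_mono norm_blinfun_compose norm_ge_zero)
    also have "\<dots> \<le> norm J * (C * norm (fst_blinfun :: ((real ^ 'n) \<times> (real ^ 'n)) \<Rightarrow>\<^sub>L _)) + norm A"
      by (intro add_right_mono mult_left_mono mult_right_mono bound norm_ge_zero)
    finally show ?thesis .
  qed
  then show "\<exists>C'>0. \<forall>z. norm (hess (Lyap lam \<phi> \<Phi>) z) \<le> C'"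
    unfolding hess
    by (intro exI[of _ "max 1 (norm J * (C * norm (fst_blinfun :: ((real ^ 'n) \<times> (real ^ 'n)) \<Rightarrow>\<^sub>L _)) + norm A)"])
       (auto simp: max.coboundedI2)
qed

section \<open>The drift inequality\<close>

text \<open>
  Growth gives \<open>|q|\<^sup>2 \<le> H/C\<close> and \<open>\<Phi> \<ge> 0\<close>, hence \<open>|p|\<^sup>2 \<le> 2H\<close>; the mixed term is split by \<open>2\<langle>q,p\<rangle> \<le> |q|\<^sup>2 + |p|\<^sup>2\<close>.
\<close>

lemma Lyap_le_Ham:
  assumes "C > 0" and "\<And>q. \<Phi> q \<ge> C * (1 + (norm q)\<^sup>2)"
    and "c1 lam \<phi> \<ge> 0" and "c2 lam \<phi> \<ge> 0"
  shows "Lyap lam \<phi> \<Phi> (q, p) \<le> (1 + c1 lam \<phi> + (c1 lam \<phi> + c2 lam \<phi>) / (2 * C)) * Ham \<Phi> (q, p)"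
proof -
  let ?c = "c1 lam \<phi>" and ?d = "c2 lam \<phi>" and ?H = "Ham \<Phi> (q, p)"
  have q: "C * (norm q)\<^sup>2 \<le> \<Phi> q"
    using assms(1) assms(2)[of q] by (simp add: algebra_simps)
  moreover have "0 \<le> C * (norm q)\<^sup>2"
    using assms(1) by simp
  ultimately have \<Phi>: "\<Phi> q \<ge> 0"
    by linarith
  have qH: "(norm q)\<^sup>2 \<le> ?H / C"
    using q assms(1) by (simp add: Ham_def field_simps add_increasing2)
  have pH: "(norm p)\<^sup>2 \<le> 2 * ?H"
    using \<Phi> by (simp add: Ham_def)
  have "q \<bullet> p \<le> norm q * norm p"
    by (rule norm_cauchy_schwarz)
  also have "\<dots> \<le> ((norm q)\<^sup>2 + (norm p)\<^sup>2) / 2"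
    using sum_squares_bound[of "norm q" "norm p"] by simp
  also have "\<dots> \<le> ?H / C / 2 + ?H"
    using qH pH by simp
  finally have "?c * (q \<bullet> p) \<le> ?c * (?H / C / 2 + ?H)"
    using assms(3) by (rule mult_left_mono)
  moreover have "?d * ((norm q)\<^sup>2 / 2) \<le> ?d * (?H / C / 2)"
    using qH assms(4) by (intro mult_left_mono) auto
  moreover have "Lyap lam \<phi> \<Phi> (q, p) = ?H + ?c * (q \<bullet> p) + ?d * ((norm q)\<^sup>2 / 2)"
    by (simp add: Lyap_def Ham_def)
  ultimately have "Lyap lam \<phi> \<Phi> (q, p) \<le> ?H + ?c * (?H / C / 2 + ?H) + ?d * (?H / C / 2)"
    by linarith
  also have "\<dots> = (1 + ?c + (?c + ?d) / (2 * C)) * ?H"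
    using assms(1) by (simp add: field_simps)
  finally show ?thesis .
qed

theorem proposition6p1:
  fixes lam \<phi> :: real
    and \<Phi> :: "real ^ 'n \<Rightarrow> real"
    and \<theta> :: "real \<Rightarrow> (real ^ 'n) \<times> (real ^ 'n) \<Rightarrow> (real ^ 'n) \<times> (real ^ 'n)"
  assumes lam: "lam > 0"
    and phi: "0 < \<phi>" "\<phi> \<le> pi / 2"
    and Phi_C2: "C2_fun \<Phi>"
    and H1: "\<forall>q. \<Phi> q \<ge> 0"
      "integrable lborel (\<lambda>q. (norm q)\<^sup>2 * exp (- \<Phi> q))"
    and H2: "\<exists>a b. a > 0 \<and> 0 < b \<and> b < 1 \<and>
      (\<forall>q. 1 / 2 * (grad \<Phi> q \<bullet> q) \<ge>
        b * \<Phi> q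
        + ((c1 lam \<phi> * b)\<^sup>2 + c2 lam \<phi> * b * (1 - b)) / (2 * (1 - b)) * (norm q)\<^sup>2
        - a)"
    and hess_bound: "\<exists>C>0. \<forall>q. norm (hess \<Phi> q) \<le> C"
    and growth: "\<exists>C>0. \<forall>q. \<Phi> q \<ge> C * (1 + (norm q)\<^sup>2)"
    and integrator: "\<forall>f :: (real ^ 'n) \<times> (real ^ 'n) \<Rightarrow> real.
      C2_fun f \<and> (\<exists>C\<^sub>1>0. \<forall>z. norm (hess f z) \<le> C\<^sub>1) \<longrightarrow>
      (\<exists>R :: (real ^ 'n) \<Rightarrow> (real ^ 'n) \<Rightarrow> real \<Rightarrow> real. \<exists>C\<^sub>2>0.
        \<forall>\<^sub>F h in at_right 0. \<forall>q p.
          f (\<theta> h (q, p)) = f (q, p) + h * Liouville \<Phi> f (q, p) + R q p h \<and>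
          \<bar>R q p h\<bar> \<le> C\<^sub>2 * (1 + Ham \<Phi> (q, p)) * h\<^sup>2)"
  shows "\<forall>\<^sub>F h in at_right 0. \<exists>\<gamma>>0. \<exists>K\<ge>0. \<forall>q p.
      Lh1 lam \<phi> \<theta> h (Lyap lam \<phi> \<Phi>) (q, p) \<le> - \<gamma> * Lyap lam \<phi> \<Phi> (q, p) + K"
proof -
  have sin: "sin \<phi> > 0"
    using phi pi_gt_zero by (intro sin_gt_zero) auto
  let ?c = "c1 lam \<phi>" and ?d = "c2 lam \<phi>" and ?V = "Lyap lam \<phi> \<Phi>" and ?D = "real CARD('n)"
  have c: "?c > 0"
    using sin lam by (simp add: c1_def)
  have d: "?d \<ge> 0"
    using c lam by (simp add: c2_def)
  have diff: "\<Phi> differentiable (at x)" for x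
    using Phi_C2 by (simp add: C2_fun_def)
  obtain a b where a: "a > 0" and b: "0 < b" "b < 1"
    and ab: "\<And>q. 1 / 2 * (grad \<Phi> q \<bullet> q) \<ge> b * \<Phi> q
        + ((?c * b)\<^sup>2 + ?d * b * (1 - b)) / (2 * (1 - b)) * (norm q)\<^sup>2 - a"
    using H2 by blast
  obtain C where C: "C > 0" "\<And>q. \<Phi> q \<ge> C * (1 + (norm q)\<^sup>2)"
    using growth by blast
  define M where "M = 1 + ?c + (?c + ?d) / (2 * C)"
  have M: "M > 0"
    using c d C(1) by (auto simp: M_def intro!: add_pos_nonneg)
  have H0: "Ham \<Phi> z \<ge> 0" for z
    using H1(1) by (cases z) (simp add: Ham_def)
  obtain C\<^sub>0 where "\<And>q. norm (hess \<Phi> q) \<le> C\<^sub>0"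
    using hess_bound by blast
  then have V: "C2_fun ?V \<and> (\<exists>C'>0. \<forall>z. norm (hess ?V z) \<le> C')"
    by (intro conjI C2_fun_Lyap[OF Phi_C2])
  obtain R :: "(real ^ 'n) \<Rightarrow> (real ^ 'n) \<Rightarrow> real \<Rightarrow> real" and C\<^sub>2
    where C\<^sub>2: "C\<^sub>2 > 0"
      and R: "\<forall>\<^sub>F h in at_right 0. \<forall>q p.
          ?V (\<theta> h (q, p)) = ?V (q, p) + h * Liouville \<Phi> ?V (q, p) + R q p h \<and>
          \<bar>R q p h\<bar> \<le> C\<^sub>2 * (1 + Ham \<Phi> (q, p)) * h\<^sup>2"
    using integrator[rule_format, OF V] by blast
  define \<gamma> where "\<gamma> = ?c * b / M"
  define K where "K = 2 * ?c * (a + ?D) + ?c * b"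
  have \<gamma>: "\<gamma> > 0" and K: "K \<ge> 0"
    using c b a M by (auto simp: \<gamma>_def K_def)
  \<comment> \<open>For these step sizes the integration error consumes at most half of the dissipation rate
    \<open>2c\<^sub>1b\<close> of the energy.\<close>
  have "\<forall>\<^sub>F h in at_right 0. h < ?c * b / C\<^sub>2"
    using c b C\<^sub>2 by (intro order_tendstoD[OF tendsto_ident_at]) auto
  with R eventually_at_right_less[of 0]
  have "\<forall>\<^sub>F h in at_right 0. \<forall>q p. Lh1 lam \<phi> \<theta> h ?V (q, p) \<le> - \<gamma> * ?V (q, p) + K"
  proof eventually_elim
    case (elim h)
    show ?case
    proof (intro allI)
      fix q p
      let ?H = "Ham \<Phi> (q, p)"
      have h: "h > 0" and hC: "C\<^sub>2 * h \<le> ?c * b"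
        using elim C\<^sub>2 by (auto simp: field_simps)
      have "inverse h * (?V (\<theta> h (q, p)) - ?V (q, p)) = Liouville \<Phi> ?V (q, p) + R q p h / h"
        using elim h by (simp add: field_simps)
      moreover have "R q p h / h \<le> C\<^sub>2 * h * (1 + ?H)"
      proof -
        have "R q p h \<le> C\<^sub>2 * (1 + ?H) * h\<^sup>2"
          using elim by (meson abs_le_D1)
        then show ?thesis
          using h by (simp add: field_simps power2_eq_square)
      qed
      moreover have "C\<^sub>2 * h * (1 + ?H) \<le> ?c * b * (1 + ?H)"
        using hC H0[of "(q, p)"] by (intro mult_right_mono) auto
      \<comment> \<open>The terms \<open>c\<^sub>2\<langle>q,p\<rangle>\<close> of the two parts of the dynamics cancel here.\<close>
      ultimately have "Lh1 lam \<phi> \<theta> h ?V (q, p)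
          \<le> - ?c * (norm p)\<^sup>2 - ?c * (grad \<Phi> q \<bullet> q) + 2 * ?c * ?D + ?c * b * (1 + ?H)"
        unfolding Lh1_def expectation_Lyap_mom_rand[OF lam] Liouville_Lyap[OF diff] by linarith
      moreover have "- ?c * (norm p)\<^sup>2 - ?c * (grad \<Phi> q \<bullet> q) \<le> - 2 * ?c * b * ?H + 2 * ?c * a"
      proof -
        \<comment> \<open>The coefficient of \<open>|q|\<^sup>2\<close> is nonnegative because \<open>b < 1\<close> and \<open>c\<^sub>2 \<ge> 0\<close>.\<close>
        have "0 \<le> ((?c * b)\<^sup>2 + ?d * b * (1 - b)) / (2 * (1 - b)) * (norm q)\<^sup>2"
          using b d by simp
        with ab[of q] have "grad \<Phi> q \<bullet> q \<ge> 2 * b * \<Phi> q - 2 * a"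
          by linarith
        moreover have "(norm p)\<^sup>2 \<ge> b * (norm p)\<^sup>2"
          using b by (simp add: mult_left_le_one_le)
        ultimately have "2 * b * ?H - 2 * a \<le> (norm p)\<^sup>2 + grad \<Phi> q \<bullet> q"
          by (simp add: Ham_def algebra_simps)
        from mult_left_mono[OF this, of ?c] show ?thesis
          using c by (simp add: algebra_simps)
      qed
      moreover have "\<gamma> * ?V (q, p) \<le> ?c * b * ?H"
      proof -
        have "?V (q, p) \<le> M * ?H"
          unfolding M_def using Lyap_le_Ham[OF C] c d by simp
        from mult_left_mono[OF this, of \<gamma>] show ?thesis
          using \<gamma> M by (simp add: \<gamma>_def)
      qed
      ultimately show "Lh1 lam \<phi> \<theta> h ?V (q, p) \<le> - \<gamma> * ?V (q, p) + K"
        by (simp add: K_def algebra_simps)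
    qed
  qed
  then show ?thesis
    by eventually_elim (use \<gamma> K in blast)
qed

end
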